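(* (a) Let $\lambda\in\mathbb C$ be such that $\mathfrak D(\lambda)\notin[-2,2]$. Then $$e^{-a\left(\operatorname{Im}k(\lambda)+\sqrt{m^2+(\operatorname{Im}\lambda)^2}\right)}\le\gamma_\pm(\lambda)\le1.$$ (b) Let $\lambda_0\in\mathbb R$ be such that $\mathfrak D(\lambda_0)\in[-2,2]$. Then $$e^{-am}\le\liminf_{\lambda\to\lambda_0}\gamma_\pm(\lambda)\le1,$$ where $\lambda$ ranges over complex numbers with $\mathfrak D(\lambda)\notin[-2,2]$.
   Context: Setting: $m\ge0$, $a>0$, and $q:\mathbb R\to\mathbb R$ is locally integrable and $a$-periodic. Pauli matrices: $\sigma_2=\begin{pmatrix}0&-i\\i&0\end{pmatrix}$, $\sigma_3=\begin{pmatrix}1&0\\0&-1\end{pmatrix}$; $\mathbb I$ is the $2\times2$ unit matrix; $|w|=\sqrt{|w_1|^2+|w_2|^2}$ for $w\in\mathbb C^2$. For $\lambda\in\mathbb C$, $\Phi(\cdot,\lambda)$ is the $2\times2$ matrix solution of $-i\sigma_2\Phi'+(m\sigma_3+q)\Phi=\lambda\Phi$ on $\mathbb R$, $\Phi(0,\lambda)=\mathbb I$. The monodromy matrix is $M(\lambda)=\Phi(a,\lambda)$ (of determinant 1), the discriminant is $\mathfrak D(\lambda)=\operatorname{Tr}M(\lambda)$; $\mathfrak D(\lambda)\in[-2,2]$ only for real $\lambda$. Quasimomentum: on $\{\operatorname{Im}\lambda\ge0\}$, $k$ is a continuous function with $\mathfrak D(\lambda)=2\cos(k(\lambda)a)$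 and $\operatorname{Im}k(\lambda)\ge0$; for $\operatorname{Im}\lambda<0$, $k(\lambda):=-\overline{k(\overline\lambda)}$. If $\mathfrak D(\lambda)\notin[-2,2]$, the eigenvalues of $M(\lambda)$ are $\rho(\lambda)=e^{-ik(\lambda)a}$ (outside the unit circle) and $1/\rho(\lambda)=e^{ik(\lambda)a}$ (inside the unit circle); $v_+(\lambda),v_-(\lambda)\in\mathbb C^2\setminus\{0\}$ denote corresponding eigenvectors, respectively. The functions $\varphi_\pm(x,\lambda)=e^{\pm ik(\lambda)x}\,\Phi(x,\lambda)v_\pm(\lambda)$ are $a$-periodic in $x$, and $$\gamma_\pm(\lambda)=\frac{|\varphi_\pm(0,\lambda)|}{\sup_{x\in[0,a]}|\varphi_\pm(x,\lambda)|}.$$ *)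

theory Defs
  imports "HOL-Analysis.Analysis"
begin

definition pauli2 :: "complex^2^2" where
  "pauli2 = vector [vector [0, - \<i>], vector [\<i>, 0]]"

definition pauli3 :: "complex^2^2" where
  "pauli3 = vector [vector [1, 0], vector [0, - 1]]"

text \<open>Absolute continuity on a set of reals: the elements of a division are non-overlapping
  nonempty compact intervals, so Inf and Sup pick out their endpoints.\<close>

definition abs_continuous_on :: "real set \<Rightarrow> (real \<Rightarrow> 'a::real_normed_vector) \<Rightarrow> bool" where
  "abs_continuous_on S f \<longleftrightarrow>
     (\<forall>\<epsilon>>0. \<exists>\<delta>>0. \<forall>D T. D division_of T \<longrightarrow> T \<subseteq> S \<longrightarrow> (\<Sum>K\<in>D. measure lborel K) < \<delta> \<longrightarrow>
        (\<Sum>K\<in>D. norm (f (Sup K) - f (Inf K))) < \<epsilon>)"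

text \<open>Since the potential is only locally integrable, a solution of
  \<open>-i \<sigma>\<^sub>2 \<Psi>' + (m \<sigma>\<^sub>3 + q) \<Psi> = z \<Psi>\<close> is a locally absolutely continuous function that satisfies the
  equation almost everywhere. Scalars act through the scalar matrices \<open>mat c\<close>.\<close>

definition dirac_solution ::
  "real \<Rightarrow> (real \<Rightarrow> real) \<Rightarrow> complex \<Rightarrow> (real \<Rightarrow> complex^2^2) \<Rightarrow> bool" where
  "dirac_solution m q z \<Psi> \<longleftrightarrow>
     (\<forall>c d. abs_continuous_on {c..d} \<Psi>) \<and>
     (AE x in lebesgue. \<exists>\<Psi>'. (\<Psi> has_vector_derivative \<Psi>') (at x) \<and>
        mat (- \<i>) ** pauli2 ** \<Psi>' +
          (mat (of_real m) ** pauli3 + mat (of_real (q x))) ** \<Psi> x = mat z ** \<Psi> x)"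

definition canonical_solution ::
  "real \<Rightarrow> (real \<Rightarrow> real) \<Rightarrow> (real \<Rightarrow> complex \<Rightarrow> complex^2^2) \<Rightarrow> bool" where
  "canonical_solution m q \<Phi> \<longleftrightarrow>
     (\<forall>z. dirac_solution m q z (\<lambda>x. \<Phi> x z) \<and> \<Phi> 0 z = mat 1)"

definition monodromy :: "real \<Rightarrow> (real \<Rightarrow> complex \<Rightarrow> complex^2^2) \<Rightarrow> complex \<Rightarrow> complex^2^2" where
  "monodromy a \<Phi> z = \<Phi> a z"

definition discriminant :: "real \<Rightarrow> (real \<Rightarrow> complex \<Rightarrow> complex^2^2) \<Rightarrow> complex \<Rightarrow> complex" where
  "discriminant a \<Phi> z = trace (monodromy a \<Phi> z)"

definition instability_set :: "real \<Rightarrow> (real \<Rightarrow> complex \<Rightarrow> complex^2^2) \<Rightarrow> complex set" where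
  "instability_set a \<Phi> = {z. discriminant a \<Phi> z \<notin> of_real ` {-2..2}}"

definition quasimomentum ::
  "real \<Rightarrow> (real \<Rightarrow> complex \<Rightarrow> complex^2^2) \<Rightarrow> (complex \<Rightarrow> complex) \<Rightarrow> bool" where
  "quasimomentum a \<Phi> k \<longleftrightarrow>
     continuous_on {z. Im z \<ge> 0} k \<and>
     (\<forall>z. Im z \<ge> 0 \<longrightarrow> discriminant a \<Phi> z = 2 * cos (k z * of_real a) \<and> Im (k z) \<ge> 0) \<and>
     (\<forall>z. Im z < 0 \<longrightarrow> k z = - cnj (k (cnj z)))"

text \<open>The parameter \<open>s\<close> is the sign of the index: \<open>s = 1\<close> gives \<open>v\<^sub>+\<close>, belonging to the eigenvalue
  \<open>e\<^sup>-\<^sup>i\<^sup>k\<^sup>a\<close>, and \<open>s = -1\<close> gives \<open>v\<^sub>-\<close>, belonging to \<open>e\<^sup>i\<^sup>k\<^sup>a\<close>. Likewise for \<open>\<phi>\<^sub>\<plusminus>\<close> and \<open>\<gamma>\<^sub>\<plusminus>\<close>.\<close>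

definition floquet_eigenvectors ::
  "real \<Rightarrow> real \<Rightarrow> (real \<Rightarrow> complex \<Rightarrow> complex^2^2) \<Rightarrow> (complex \<Rightarrow> complex) \<Rightarrow>
     (complex \<Rightarrow> complex^2) \<Rightarrow> bool" where
  "floquet_eigenvectors s a \<Phi> k v \<longleftrightarrow>
     (\<forall>z\<in>instability_set a \<Phi>.
        v z \<noteq> 0 \<and> monodromy a \<Phi> z *v v z = exp (- of_real s * \<i> * k z * of_real a) *s v z)"

definition floquet_periodic ::
  "real \<Rightarrow> (real \<Rightarrow> complex \<Rightarrow> complex^2^2) \<Rightarrow> (complex \<Rightarrow> complex) \<Rightarrow>
     (complex \<Rightarrow> complex^2) \<Rightarrow> real \<Rightarrow> complex \<Rightarrow> complex^2" where
  "floquet_periodic s \<Phi> k v x z =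
     exp (of_real s * \<i> * k z * of_real x) *s (\<Phi> x z *v v z)"

definition floquet_gamma ::
  "real \<Rightarrow> real \<Rightarrow> (real \<Rightarrow> complex \<Rightarrow> complex^2^2) \<Rightarrow> (complex \<Rightarrow> complex) \<Rightarrow>
     (complex \<Rightarrow> complex^2) \<Rightarrow> complex \<Rightarrow> real" where
  "floquet_gamma s a \<Phi> k v z =
     norm (floquet_periodic s \<Phi> k v 0 z) / (SUP x\<in>{0..a}. norm (floquet_periodic s \<Phi> k v x z))"

end

(* For a solution u of the Dirac system, (|u|^2)' = 4 Re ((m + i Im z) cnj u_1 u_2), in which q
   cancels; so |u|^2 grows or decays at a rate of at most 2 sqrt (m^2 + (Im z)^2). Multiplying by
   |e^{+-ikx}| <= e^{a Im k} gives (a). For (b), Im k is continuous on the whole plane, because k is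
   extended by reflection, and vanishes where the discriminant lies in [-2,2]. The upper bound on the
   lower limit needs in addition that the limit point is not isolated, which holds since non-real
   spectral parameters always have discriminant outside [-2,2].
   As solutions are merely absolutely continuous, differential inequalities that hold almost
   everywhere are integrated with a gauge argument. *)
theory Submission
  imports Defs
begin

section \<open>Absolutely continuous functions\<close>

text \<open>The intervals of a division of a subset of \<open>S\<close> have both endpoints in
  \<open>S\<close>, so the bound on increments can be summed over the division. The closure
  properties below, under linear maps, sums, products and Lipschitz maps, are all instances or
  consequences.\<close>

lemma abs_continuous_on_dominated:
  assumes f: "abs_continuous_on S f" and g: "abs_continuous_on S g" and "C \<ge> 0"
    and h: "\<And>x y. x \<in> S \<Longrightarrow> y \<in> S \<Longrightarrow>
      norm (h y - h x) \<le> C * (norm (f y - f x) + norm (g y - g x))"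
  shows "abs_continuous_on S h"
  unfolding abs_continuous_on_def
proof (intro allI impI)
  fix \<epsilon> :: real assume "\<epsilon> > 0"
  \<comment> \<open>The \<open>1\<close> added to \<open>C\<close> allows \<open>C = 0\<close>, and
    it makes the final bound \<open>\<epsilon> * (C / (C + 1))\<close> strictly smaller than
    \<open>\<epsilon>\<close>.\<close>
  define e where "e = \<epsilon> / (C + 1) / 2"
  have "e > 0" using \<open>\<epsilon> > 0\<close> \<open>C \<ge> 0\<close> by (simp add: e_def)
  obtain d1 where d1: "d1 > 0" "\<And>D T. D division_of T \<Longrightarrow> T \<subseteq> S \<Longrightarrow>
      (\<Sum>K\<in>D. measure lborel K) < d1 \<Longrightarrow> (\<Sum>K\<in>D. norm (f (Sup K) - f (Inf K))) < e"
    using f \<open>e > 0\<close> unfolding abs_continuous_on_def by blast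
  obtain d2 where d2: "d2 > 0" "\<And>D T. D division_of T \<Longrightarrow> T \<subseteq> S \<Longrightarrow>
      (\<Sum>K\<in>D. measure lborel K) < d2 \<Longrightarrow> (\<Sum>K\<in>D. norm (g (Sup K) - g (Inf K))) < e"
    using g \<open>e > 0\<close> unfolding abs_continuous_on_def by blast
  show "\<exists>\<delta>>0. \<forall>D T. D division_of T \<longrightarrow> T \<subseteq> S \<longrightarrow> (\<Sum>K\<in>D. measure lborel K) < \<delta> \<longrightarrow>
      (\<Sum>K\<in>D. norm (h (Sup K) - h (Inf K))) < \<epsilon>"
  proof (intro exI[of _ "min d1 d2"] conjI allI impI)
    fix D T assume D: "D division_of T" and T: "T \<subseteq> S"
      and small: "(\<Sum>K\<in>D. measure lborel K) < min d1 d2"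
    have "(\<Sum>K\<in>D. norm (h (Sup K) - h (Inf K)))
        \<le> (\<Sum>K\<in>D. C * (norm (f (Sup K) - f (Inf K)) + norm (g (Sup K) - g (Inf K))))"
    proof (rule sum_mono)
      fix K assume K: "K \<in> D"
      obtain u v where uv: "K = cbox u v" using division_ofD(4)[OF D K] by blast
      have "u \<le> v" using division_ofD(3)[OF D K] by (auto simp: uv)
      have "K \<subseteq> S" using division_ofD(2)[OF D K] T by blast
      then have "u \<in> S" "v \<in> S" using \<open>u \<le> v\<close> by (auto simp: uv)
      then show "norm (h (Sup K) - h (Inf K))
          \<le> C * (norm (f (Sup K) - f (Inf K)) + norm (g (Sup K) - g (Inf K)))"
        using h[of u v] \<open>u \<le> v\<close> by (simp add: uv)
    qed
    also have "\<dots> = C * ((\<Sum>K\<in>D. norm (f (Sup K) - f (Inf K)))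
        + (\<Sum>K\<in>D. norm (g (Sup K) - g (Inf K))))"
      by (simp add: sum_distrib_left sum.distrib distrib_left)
    also have "\<dots> \<le> C * (e + e)"
      using d1(2)[OF D T] d2(2)[OF D T] small \<open>C \<ge> 0\<close> by (intro mult_left_mono) auto
    also have "\<dots> = \<epsilon> * (C / (C + 1))"
      using field_sum_of_halves[of "\<epsilon> / (C + 1)"] by (simp add: e_def del: divide_divide_eq_left)
    also have "\<dots> < \<epsilon> * 1"
      using \<open>\<epsilon> > 0\<close> \<open>C \<ge> 0\<close> by (intro mult_strict_left_mono) (auto simp: divide_less_eq)
    finally show "(\<Sum>K\<in>D. norm (h (Sup K) - h (Inf K))) < \<epsilon>" by simp
  qed (use d1(1) d2(1) in auto)
qed

text \<open>A single interval is a division of itself, so the \<open>\<delta>\<close> of absolute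
  continuity works for each pair of points.\<close>

lemma abs_continuous_on_imp_continuous_on:
  assumes f: "abs_continuous_on {c..d} f"
  shows "continuous_on {c..d} f"
proof (rule continuous_on_iff[THEN iffD2], intro ballI allI impI)
  fix x :: real and e :: real assume x: "x \<in> {c..d}" and "e > 0"
  obtain \<delta> where \<delta>: "\<delta> > 0" "\<And>D T. D division_of T \<Longrightarrow> T \<subseteq> {c..d} \<Longrightarrow>
      (\<Sum>K\<in>D. measure lborel K) < \<delta> \<Longrightarrow> (\<Sum>K\<in>D. norm (f (Sup K) - f (Inf K))) < e"
    using f \<open>e > 0\<close> unfolding abs_continuous_on_def by blast
  have close: "norm (f t - f s) < e" if "s \<in> {c..d}" "t \<in> {c..d}" "s \<le> t" "t - s < \<delta>" for s t
  proof -
    have "{{s..t}} division_of {s..t}"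
      using that division_of_self[of s t] by auto
    from \<delta>(2)[OF this] that show ?thesis by auto
  qed
  show "\<exists>\<delta>>0. \<forall>x'\<in>{c..d}. dist x' x < \<delta> \<longrightarrow> dist (f x') (f x) < e"
  proof (intro exI[of _ \<delta>] conjI ballI impI)
    fix y assume y: "y \<in> {c..d}" "dist y x < \<delta>"
    show "dist (f y) (f x) < e"
      using close[of x y] close[of y x] x y
      by (cases "x \<le> y") (auto simp: dist_norm norm_minus_commute)
  qed (rule \<delta>(1))
qed

lemma abs_continuous_on_bounded_linear:
  assumes "bounded_linear L" and f: "abs_continuous_on S f"
  shows "abs_continuous_on S (\<lambda>x. L (f x))"
proof -
  obtain B where B: "B > 0" "\<And>x. norm (L x) \<le> norm x * B"
    using bounded_linear.pos_bounded[OF assms(1)] by blast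
  show ?thesis
  \<comment> \<open>The only dominating function, \<open>f\<close>, fills both places.\<close>
  proof (rule abs_continuous_on_dominated[OF f f, of B])
    fix x y
    have "norm (L (f y) - L (f x)) \<le> B * norm (f y - f x)"
      using B(2)[of "f y - f x"] linear_diff[OF bounded_linear.linear[OF assms(1)]]
      by (simp add: mult.commute)
    also have "\<dots> \<le> B * (norm (f y - f x) + norm (f y - f x))"
      using B(1) by (intro mult_left_mono) auto
    finally show "norm (L (f y) - L (f x)) \<le> \<dots>" .
  qed (use B in auto)
qed

lemma abs_continuous_on_const: "abs_continuous_on S (\<lambda>x. c)"
  unfolding abs_continuous_on_def by (auto intro: exI[of _ 1])

lemma abs_continuous_on_ident: "abs_continuous_on S (\<lambda>x. x)"
  unfolding abs_continuous_on_def
proof (intro allI impI)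
  fix \<epsilon> :: real assume "\<epsilon> > 0"
  have "(\<Sum>K\<in>D. norm (Sup K - Inf K)) = (\<Sum>K\<in>D. measure lborel K)" if D: "D division_of T" for D :: "real set set" and T
  proof (rule sum.cong[OF refl])
    fix K assume K: "K \<in> D"
    obtain u v where uv: "K = cbox u v" using division_ofD(4)[OF D K] by blast
    moreover have "u \<le> v" using division_ofD(3)[OF D K] by (auto simp: uv)
    ultimately show "norm (Sup K - Inf K) = measure lborel K" by simp
  qed
  then show "\<exists>\<delta>>0. \<forall>D T. D division_of T \<longrightarrow> T \<subseteq> S \<longrightarrow> (\<Sum>K\<in>D. measure lborel K) < \<delta> \<longrightarrow>
      (\<Sum>K\<in>D. norm (Sup K - Inf K)) < \<epsilon>"
    using \<open>\<epsilon> > 0\<close> by (intro exI[of _ \<epsilon>]) metis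
qed

lemma abs_continuous_on_add:
  assumes "abs_continuous_on S f" "abs_continuous_on S g"
  shows "abs_continuous_on S (\<lambda>x. f x + g x)"
  by (rule abs_continuous_on_dominated[OF assms, of 1])
    (auto simp: add_diff_add intro: norm_triangle_ineq)

lemma abs_continuous_on_diff:
  assumes "abs_continuous_on S f" "abs_continuous_on S g"
  shows "abs_continuous_on S (\<lambda>x. f x - g x)"
proof -
  have "abs_continuous_on S (\<lambda>x. f x + - g x)"
    by (intro abs_continuous_on_add assms
        abs_continuous_on_bounded_linear[OF bounded_linear_minus[OF bounded_linear_ident]])
  then show ?thesis by simp
qed

text \<open>Both factors are continuous, hence bounded on the compact interval, and the increment of
  the product splits as in the product rule.\<close>

lemma abs_continuous_on_mult:
  fixes f g :: "real \<Rightarrow> 'a::real_normed_algebra"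
  assumes f: "abs_continuous_on {c..d} f" and g: "abs_continuous_on {c..d} g"
  shows "abs_continuous_on {c..d} (\<lambda>x. f x * g x)"
proof -
  have "bounded (f ` {c..d})" "bounded (g ` {c..d})"
    using assms[THEN abs_continuous_on_imp_continuous_on]
    by (auto intro!: compact_imp_bounded compact_continuous_image)
  then obtain A B where A: "A > 0" "\<And>x. x \<in> {c..d} \<Longrightarrow> norm (f x) \<le> A"
    and B: "B > 0" "\<And>x. x \<in> {c..d} \<Longrightarrow> norm (g x) \<le> B"
    unfolding bounded_pos by auto
  show ?thesis
  proof (rule abs_continuous_on_dominated[OF f g, of "A + B"])
    fix x y assume xy: "x \<in> {c..d}" "y \<in> {c..d}"
    have "f y * g y - f x * g x = (f y - f x) * g y + f x * (g y - g x)"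
      by (simp add: algebra_simps)
    then have "norm (f y * g y - f x * g x) \<le> norm ((f y - f x) * g y) + norm (f x * (g y - g x))"
      by (metis norm_triangle_ineq)
    also have "\<dots> \<le> norm (f y - f x) * norm (g y) + norm (f x) * norm (g y - g x)"
      by (intro add_mono norm_mult_ineq)
    also have "\<dots> \<le> norm (f y - f x) * (A + B) + (A + B) * norm (g y - g x)"
      using A(1) B(1) A(2)[OF xy(1)] B(2)[OF xy(2)]
      by (intro add_mono mult_left_mono mult_right_mono) auto
    finally show "norm (f y * g y - f x * g x)
        \<le> (A + B) * (norm (f y - f x) + norm (g y - g x))"
      by (simp add: algebra_simps)
  qed (use A B in auto)
qed

lemma abs_continuous_on_lipschitz:
  assumes "L-lipschitz_on S f"
  shows "abs_continuous_on S f"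
proof (rule abs_continuous_on_dominated[OF abs_continuous_on_ident abs_continuous_on_ident, of L])
  show "L \<ge> 0" using assms by (rule lipschitz_on_nonneg)
  fix x y assume "x \<in> S" "y \<in> S"
  then have "norm (f y - f x) \<le> L * norm (y - x)"
    using lipschitz_onD[OF assms, of y x] by (simp add: dist_norm)
  also have "\<dots> \<le> L * (norm (y - x) + norm (y - x))"
    using \<open>L \<ge> 0\<close> by (intro mult_left_mono) auto
  finally show "norm (f y - f x) \<le> \<dots>" .
qed

text \<open>The derivative is bounded on a compact interval, so the function is Lipschitz there. It
  serves as the integrating factor in the Gronwall inequality.\<close>

lemma abs_continuous_on_exp:
  "abs_continuous_on {c..d} (\<lambda>x. exp (C * x :: real))"
proof -
  have "bounded ((\<lambda>x. C * exp (C * x)) ` {c..d})"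
    by (intro compact_imp_bounded compact_continuous_image continuous_intros compact_Icc)
  then obtain B where B: "B > 0" "\<And>x. x \<in> {c..d} \<Longrightarrow> norm (C * exp (C * x)) \<le> B"
    unfolding bounded_pos by auto
  have "B-lipschitz_on {c..d} (\<lambda>x. exp (C * x))"
  proof (rule bounded_derivative_imp_lipschitz)
    fix x assume x: "x \<in> {c..d}"
    show "((\<lambda>x. exp (C * x)) has_derivative (\<lambda>h. h * (C * exp (C * x)))) (at x within {c..d})"
      by (auto intro!: derivative_eq_intros simp: algebra_simps)
    show "onorm (\<lambda>h. h * (C * exp (C * x))) \<le> B"
    proof (rule onorm_le)
      fix h :: real
      show "norm (h * (C * exp (C * x))) \<le> B * norm h"
        using mult_left_mono[OF B(2)[OF x], of "\<bar>h\<bar>"] by (simp add: abs_mult mult.commute)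
    qed
  qed (use B in auto)
  then show ?thesis by (rule abs_continuous_on_lipschitz)
qed

section \<open>Monotonicity and the Gronwall inequality from derivatives almost everywhere\<close>

text \<open>The increment \<open>f d - f c\<close> telescopes over a fine tagged division. Where the
  tag is a point with nonnegative derivative, the increment is at least \<open>- \<eta>\<close>
  times the length; the intervals tagged in the exceptional null set have small total length, so
  absolute continuity bounds their increments.\<close>

lemma abs_continuous_on_AE_nonneg_deriv_imp_le:
  fixes f :: "real \<Rightarrow> real"
  assumes "c \<le> d" and ac: "abs_continuous_on {c..d} f"
    and deriv: "AE x in lebesgue. x \<in> {c..d} \<longrightarrow> (\<exists>f'\<ge>0. (f has_vector_derivative f') (at x))"
  shows "f c \<le> f d"
proof (rule field_le_epsilon)
  fix e :: real assume "e > 0"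
  \<comment> \<open>Of the error \<open>e\<close>, the share \<open>\<eta> * (d - c)\<close> goes to
    the good tags and \<open>\<eta>\<close> to the exceptional ones. The \<open>1\<close> covers the
    case \<open>c = d\<close>.\<close>
  define \<eta> where "\<eta> = e / (d - c + 1)"
  have "\<eta> > 0" using \<open>e > 0\<close> \<open>c \<le> d\<close> by (simp add: \<eta>_def)
  have "\<eta> * (d - c + 1) = e" using \<open>c \<le> d\<close> by (simp add: \<eta>_def)
  then have \<eta>: "\<eta> * (d - c) + \<eta> = e" by (simp add: algebra_simps)
  obtain N where null: "N \<in> null_sets lebesgue" "{x \<in> space lebesgue. \<not> (x \<in> {c..d} \<longrightarrow>
      (\<exists>f'\<ge>0. (f has_vector_derivative f') (at x)))} \<subseteq> N"
    using deriv unfolding eventually_ae_filter by blast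
  have deriv_N: "\<exists>f'\<ge>0. (f has_vector_derivative f') (at x)" if "x \<in> {c..d} - N" for x
    using null that by auto
  obtain \<delta> where \<delta>: "\<delta> > 0" "\<And>D T. D division_of T \<Longrightarrow> T \<subseteq> {c..d} \<Longrightarrow>
      (\<Sum>K\<in>D. measure lborel K) < \<delta> \<Longrightarrow> (\<Sum>K\<in>D. norm (f (Sup K) - f (Inf K))) < \<eta>"
    using ac \<open>\<eta> > 0\<close> unfolding abs_continuous_on_def by blast
  \<comment> \<open>Outer regularity gives an open \<open>T\<close> around \<open>N\<close> with
    \<open>T - N\<close> small; since \<open>N\<close> is null, \<open>T\<close> itself is as
    small.\<close>
  obtain U where U: "open U" "N \<subseteq> U" "U \<in> lmeasurable" "measure lebesgue U < \<delta>"
  proof -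
    have "N \<in> sets lebesgue" using null(1) by auto
    from sets_lebesgue_outer_open[OF this \<delta>(1)] obtain T where T: "open T" "N \<subseteq> T"
      "T - N \<in> lmeasurable" "emeasure lebesgue (T - N) < ennreal \<delta>" .
    have "T \<in> sets lebesgue" using \<open>open T\<close> by (simp add: borel_open)
    then have "emeasure lebesgue T < ennreal \<delta>"
      using T(4) emeasure_Diff_null_set[OF null(1)] by metis
    moreover from this have "T \<in> lmeasurable"
      using \<open>T \<in> sets lebesgue\<close> by (intro fmeasurableI) (auto intro: less_trans)
    ultimately show ?thesis
      using that T(1,2) \<delta>(1) by (simp add: emeasure_eq_measure2 ennreal_less_iff)
  qed
  \<comment> \<open>Straddling: for \<open>u\<close> and \<open>v\<close> on either side of
    \<open>x\<close>, the errors \<open>\<eta> * (x - u)\<close> and \<open>\<eta> * (v - x)\<close>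
    of the linear approximation add up to exactly \<open>\<eta> * (v - u)\<close>.\<close>
  have "\<exists>r>0. \<forall>u v. u \<le> x \<longrightarrow> x \<le> v \<longrightarrow> u \<in> ball x r \<longrightarrow> v \<in> ball x r \<longrightarrow>
      f v - f u \<ge> - \<eta> * (v - u)" if x: "x \<in> {c..d} - N" for x
  proof -
    obtain f' where f': "f' \<ge> 0" "(f has_vector_derivative f') (at x)" using deriv_N[OF x] by blast
    then obtain r where r: "r > 0" "\<And>y. norm (y - x) < r \<Longrightarrow>
        norm (f y - f x - (y - x) *\<^sub>R f') \<le> \<eta> * norm (y - x)"
      using \<open>\<eta> > 0\<close> unfolding has_vector_derivative_def has_derivative_at_alt by blast
    have "f v - f u \<ge> - \<eta> * (v - u)" if uv: "u \<le> x" "x \<le> v" "u \<in> ball x r" "v \<in> ball x r" for u v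
    proof -
      have "f v - f x - (v - x) * f' \<ge> - (\<eta> * (v - x))"
        using r(2)[of v] uv by (auto simp: dist_real_def)
      moreover have "f u - f x - (u - x) * f' \<le> \<eta> * (x - u)"
        using r(2)[of u] uv by (auto simp: dist_real_def)
      moreover have "(v - u) * f' \<ge> 0" using uv f'(1) by simp
      ultimately show ?thesis by (simp add: algebra_simps)
    qed
    then show ?thesis using r(1) by blast
  qed
  then obtain r where r: "\<And>x. x \<in> {c..d} - N \<Longrightarrow> r x > 0"
    "\<And>x u v. x \<in> {c..d} - N \<Longrightarrow> u \<le> x \<Longrightarrow> x \<le> v \<Longrightarrow>
      u \<in> ball x (r x) \<Longrightarrow> v \<in> ball x (r x) \<Longrightarrow> f v - f u \<ge> - \<eta> * (v - u)" by metis
  \<comment> \<open>An interval tagged in \<open>N\<close> must lie in \<open>U\<close>, and any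
    other one in the ball of the straddle estimate at its tag.\<close>
  define \<gamma> where "\<gamma> x = (if x \<in> N then U else if x \<in> {c..d} then ball x (r x) else UNIV)" for x
  have "gauge \<gamma>" unfolding gauge_def \<gamma>_def using U r(1) by auto
  then obtain p where p: "p tagged_division_of {c..d}" "\<gamma> fine p"
    by (rule fine_division_exists_real)
  note pD = tagged_division_ofD[OF p(1)]
  define P where "P = {xk \<in> p. fst xk \<in> N}"
  let ?g = "\<lambda>(x::real, K). f (Sup K) - f (Inf K)"
  have Pdiv: "P tagged_division_of (\<Union>(snd ` P))"
  proof (rule tagged_partial_division_of_Union_self[OF tagged_partial_division_subset])
    show "p tagged_partial_division_of {c..d}" using p(1) by (simp add: tagged_division_of_def)
  qed (auto simp: P_def)
  have Psub: "\<Union>(snd ` P) \<subseteq> {c..d} \<inter> U"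
  proof -
    have "K \<subseteq> {c..d} \<inter> U" if "(x, K) \<in> P" for x K
      using that pD(3)[of x K] fineD[OF p(2), of x K] by (auto simp: P_def \<gamma>_def)
    then show ?thesis by (intro Union_least) (metis imageE prod.collapse)
  qed
  have D: "snd ` P division_of \<Union>(snd ` P)" by (rule division_of_tagged_division[OF Pdiv])
  \<comment> \<open>The intervals do not overlap, so their total length is the measure of their
    union, which is contained in \<open>U\<close>.\<close>
  have "(\<Sum>K\<in>snd ` P. measure lborel K) = measure lebesgue (\<Union>(snd ` P))"
  proof (subst content_division[OF D, symmetric], rule sum.cong[OF refl])
    fix K assume "K \<in> snd ` P"
    then obtain u v where "K = cbox u v" using division_ofD(4)[OF D] by blast
    then show "measure lborel K = measure lebesgue K" by simp
  qed
  also have "\<dots> \<le> measure lebesgue U"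
    using Psub U(3) by (intro measure_mono_fmeasurable)
      (auto intro: fmeasurableD lmeasurable_division[OF D])
  also have "\<dots> < \<delta>" by fact
  finally have "(\<Sum>K\<in>snd ` P. norm (f (Sup K) - f (Inf K))) < \<eta>"
    using \<delta>(2)[OF D] Psub by blast
  also have "(\<Sum>K\<in>snd ` P. norm (f (Sup K) - f (Inf K)))
      = (\<Sum>(x, K)\<in>P. norm (f (Sup K) - f (Inf K)))"
  proof -
    \<comment> \<open>The lemma on tagged divisions asks for \<open>0\<close> at \<open>{}\<close>, where \<open>Sup\<close> and \<open>Inf\<close> are unspecified.\<close>
    let ?h = "\<lambda>K. if K = {} then 0 else norm (f (Sup K) - f (Inf K))"
    have "(\<Sum>(x, K)\<in>P. ?h K) = (\<Sum>K\<in>snd ` P. ?h K)"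
    proof (rule sum.over_tagged_division_lemma[OF Pdiv])
      fix u v :: real assume "box u v = {}"
      then show "?h (cbox u v) = 0" by (cases "u = v") auto
    qed
    moreover have "(\<Sum>(x, K)\<in>P. ?h K) = (\<Sum>(x, K)\<in>P. norm (f (Sup K) - f (Inf K)))"
      using tagged_division_ofD(2)[OF Pdiv] by (intro sum.cong) fastforce+
    moreover have "(\<Sum>K\<in>snd ` P. ?h K) = (\<Sum>K\<in>snd ` P. norm (f (Sup K) - f (Inf K)))"
      using division_ofD(3)[OF D] by (intro sum.cong) auto
    ultimately show ?thesis by simp
  qed
  finally have "(\<Sum>(x, K)\<in>P. norm (f (Sup K) - f (Inf K))) < \<eta>" .
  moreover have "norm (sum ?g P) \<le> (\<Sum>(x, K)\<in>P. norm (f (Sup K) - f (Inf K)))"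
    by (rule order_trans[OF norm_sum]) (simp add: case_prod_unfold)
  ultimately have bad: "sum ?g P \<ge> - \<eta>" by simp
  \<comment> \<open>The good intervals have total length at most \<open>d - c\<close>, the sum over
    the whole division; the negative factor reverses the inequality.\<close>
  have "- \<eta> * (d - c) \<le> - \<eta> * (\<Sum>(x, K)\<in>p - P. Sup K - Inf K)"
  proof -
    have "(\<Sum>(x, K)\<in>p - P. Sup K - Inf K) \<le> (\<Sum>(x, K)\<in>p. Sup K - Inf K)"
    proof (rule sum_mono2)
      fix b assume "b \<in> p - (p - P)"
      then obtain x K where b: "b = (x, K)" "(x, K) \<in> p" by (cases b) auto
      obtain u v where "K = cbox u v" using pD(4)[OF b(2)] by blast
      then show "0 \<le> (case b of (x, K) \<Rightarrow> Sup K - Inf K)"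
        using pD(2)[OF b(2)] by (auto simp: b(1))
    qed (use pD(1) in auto)
    also have "\<dots> = d - c"
      using additive_tagged_division_1[OF \<open>c \<le> d\<close> p(1), of "\<lambda>x. x"] by simp
    finally show ?thesis using \<open>\<eta> > 0\<close> by simp
  qed
  also have "\<dots> = (\<Sum>(x, K)\<in>p - P. - \<eta> * (Sup K - Inf K))"
    by (simp add: sum_distrib_left case_prod_unfold)
  also have "\<dots> \<le> sum ?g (p - P)"
  proof (rule sum_mono)
    fix b assume "b \<in> p - P"
    then obtain x K where b: "b = (x, K)" "(x, K) \<in> p" "x \<notin> N" by (cases b) (auto simp: P_def)
    have x: "x \<in> {c..d} - N" using b(3) tag_in_interval[OF p(1) b(2)] by simp
    obtain u v where uv: "K = cbox u v" using pD(4)[OF b(2)] by blast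
    have "u \<le> x" "x \<le> v" using pD(2)[OF b(2)] by (auto simp: uv)
    moreover have "K \<subseteq> ball x (r x)" using fineD[OF p(2) b(2)] x by (simp add: \<gamma>_def)
    moreover have "u \<in> K" "v \<in> K" using calculation(1,2) by (auto simp: uv)
    ultimately have "- \<eta> * (v - u) \<le> f v - f u"
      by (intro r(2)[OF x]) auto
    then show "(case b of (x, K) \<Rightarrow> - \<eta> * (Sup K - Inf K)) \<le> ?g b"
      using \<open>u \<le> x\<close> \<open>x \<le> v\<close> by (simp add: b(1) uv)
  qed
  finally have "- \<eta> * (d - c) - \<eta> \<le> sum ?g (p - P) + sum ?g P" using bad by simp
  also have "\<dots> = sum ?g p"
    using pD(1) by (subst sum.subset_diff[of P p]) (auto simp: P_def)
  also have "\<dots> = f d - f c"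
    by (rule additive_tagged_division_1[OF \<open>c \<le> d\<close> p(1)])
  finally show "f c \<le> f d + e" using \<eta> by simp
qed

text \<open>Monotonicity is applied to the real and imaginary parts and to their negatives.\<close>

lemma abs_continuous_on_AE_zero_deriv_imp_eq:
  fixes f :: "real \<Rightarrow> complex"
  assumes "c \<le> d" and ac: "abs_continuous_on {c..d} f"
    and deriv: "AE x in lebesgue. (f has_vector_derivative 0) (at x)"
  shows "f c = f d"
proof -
  have *: "L (f c) \<le> L (f d)" if L: "bounded_linear L" for L :: "complex \<Rightarrow> real"
  proof (rule abs_continuous_on_AE_nonneg_deriv_imp_le[OF \<open>c \<le> d\<close>
        abs_continuous_on_bounded_linear[OF L ac]])
    show "AE x in lebesgue. x \<in> {c..d} \<longrightarrow>
        (\<exists>f'\<ge>0. ((\<lambda>x. L (f x)) has_vector_derivative f') (at x))"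
      using deriv
    proof (rule AE_mp, intro AE_I2 impI)
      fix x assume "(f has_vector_derivative 0) (at x)"
      from bounded_linear.has_vector_derivative[OF L this]
      show "\<exists>f'\<ge>0. ((\<lambda>x. L (f x)) has_vector_derivative f') (at x)"
        by (metis L linear_0 bounded_linear.linear order_refl)
    qed
  qed
  show ?thesis
    using *[OF bounded_linear_Re] *[OF bounded_linear_minus[OF bounded_linear_Re]]
      *[OF bounded_linear_Im] *[OF bounded_linear_minus[OF bounded_linear_Im]]
    by (simp add: complex_eq_iff)
qed

text \<open>The factor \<open>exp (- C * x)\<close> turns the inequality into a nonnegative
  derivative. Neither \<open>C\<close> nor \<open>f\<close> has a prescribed sign, so applying this
  to \<open>- f\<close> gives upper bounds.\<close>

lemma abs_continuous_on_gronwall: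
  fixes f :: "real \<Rightarrow> real"
  assumes "c \<le> d" and ac: "abs_continuous_on {c..d} f"
    and deriv: "AE x in lebesgue. \<exists>f'\<ge>C * f x. (f has_vector_derivative f') (at x)"
  shows "exp (C * (d - c)) * f c \<le> f d"
proof -
  have "exp (- C * c) * f c \<le> exp (- C * d) * f d"
  proof (rule abs_continuous_on_AE_nonneg_deriv_imp_le[OF \<open>c \<le> d\<close>])
    show "abs_continuous_on {c..d} (\<lambda>x. exp (- C * x) * f x)"
      by (intro abs_continuous_on_mult abs_continuous_on_exp ac)
    show "AE x in lebesgue. x \<in> {c..d} \<longrightarrow>
        (\<exists>f'\<ge>0. ((\<lambda>x. exp (- C * x) * f x) has_vector_derivative f') (at x))"
      using deriv
    proof (rule AE_mp, intro AE_I2 impI)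
      fix x assume "\<exists>f'\<ge>C * f x. (f has_vector_derivative f') (at x)"
      then obtain f' where f': "f' \<ge> C * f x" "(f has_real_derivative f') (at x)"
        by (auto simp: has_real_derivative_iff_has_vector_derivative)
      have "((\<lambda>x. exp (- C * x) * f x) has_real_derivative exp (- C * x) * (f' - C * f x)) (at x)"
        by (auto intro!: derivative_eq_intros f'(2) simp: algebra_simps)
      moreover have "exp (- C * x) * (f' - C * f x) \<ge> 0" using f'(1) by simp
      ultimately show "\<exists>f'\<ge>0. ((\<lambda>x. exp (- C * x) * f x) has_vector_derivative f') (at x)"
        by (auto simp: has_real_derivative_iff_has_vector_derivative)
    qed
  qed
  then have "exp (C * d) * (exp (- C * c) * f c) \<le> exp (C * d) * (exp (- C * d) * f d)"
    by (intro mult_left_mono) auto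
  then have "exp (C * d + - C * c) * f c \<le> exp (C * d + - C * d) * f d"
    by (simp only: exp_add mult.assoc)
  then show ?thesis by (simp add: right_diff_distrib)
qed

section \<open>Solutions of the Dirac system\<close>

text \<open>This is the Dirac system for a vector with components \<open>f\<close> and
  \<open>g\<close>, solved for the derivatives: \<open>- \<i>\<close> times \<open>pauli2\<close> is
  the real matrix with rows (0, -1) and (1, 0).\<close>

definition dirac_vector_solution ::
  "real \<Rightarrow> (real \<Rightarrow> real) \<Rightarrow> complex \<Rightarrow> (real \<Rightarrow> complex) \<Rightarrow> (real \<Rightarrow> complex) \<Rightarrow> bool" where
  "dirac_vector_solution m q z f g \<longleftrightarrow>
     (\<forall>c d. abs_continuous_on {c..d} f \<and> abs_continuous_on {c..d} g) \<and>
     (AE x in lebesgue.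
        (f has_vector_derivative (z - of_real (q x) + of_real m) * g x) (at x) \<and>
        (g has_vector_derivative (of_real m + of_real (q x) - z) * f x) (at x))"

lemma bounded_linear_matrix_vector_mult_nth:
  "bounded_linear (\<lambda>A::complex^2^2. (A *v w) $ i)"
proof -
  have "bounded_linear (\<lambda>A::complex^2^2. A $ i $ j * w $ j)" for j
    by (rule bounded_linear_compose[OF bounded_linear_mult_left
          bounded_linear_compose[OF bounded_linear_vec_nth bounded_linear_vec_nth]])
  from bounded_linear_add[OF this[of 1] this[of 2]] show ?thesis
    by (simp add: matrix_vector_mult_def sum_2)
qed

lemma dirac_solution_imp_vector_solution:
  assumes "dirac_solution m q z \<Psi>"
  shows "dirac_vector_solution m q z (\<lambda>x. (\<Psi> x *v w) $ 1) (\<lambda>x. (\<Psi> x *v w) $ 2)"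
  unfolding dirac_vector_solution_def
proof (intro conjI allI)
  fix c d
  show "abs_continuous_on {c..d} (\<lambda>x. (\<Psi> x *v w) $ 1)"
    "abs_continuous_on {c..d} (\<lambda>x. (\<Psi> x *v w) $ 2)"
    using assms unfolding dirac_solution_def
    by (auto intro!: abs_continuous_on_bounded_linear[OF bounded_linear_matrix_vector_mult_nth])
next
  have "AE x in lebesgue. \<exists>\<Psi>'. (\<Psi> has_vector_derivative \<Psi>') (at x) \<and>
        mat (- \<i>) ** pauli2 ** \<Psi>' +
          (mat (of_real m) ** pauli3 + mat (of_real (q x))) ** \<Psi> x = mat z ** \<Psi> x"
    using assms unfolding dirac_solution_def by blast
  then show "AE x in lebesgue.
        ((\<lambda>x. (\<Psi> x *v w) $ 1) has_vector_derivative
          (z - of_real (q x) + of_real m) * (\<Psi> x *v w) $ 2) (at x) \<and>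
        ((\<lambda>x. (\<Psi> x *v w) $ 2) has_vector_derivative
          (of_real m + of_real (q x) - z) * (\<Psi> x *v w) $ 1) (at x)"
  proof (rule AE_mp, intro AE_I2 impI)
    fix x assume "\<exists>\<Psi>'. (\<Psi> has_vector_derivative \<Psi>') (at x) \<and>
        mat (- \<i>) ** pauli2 ** \<Psi>' +
          (mat (of_real m) ** pauli3 + mat (of_real (q x))) ** \<Psi> x = mat z ** \<Psi> x"
    then obtain \<Psi>' where \<Psi>': "(\<Psi> has_vector_derivative \<Psi>') (at x)"
      and eq: "mat (- \<i>) ** pauli2 ** \<Psi>' +
          (mat (of_real m) ** pauli3 + mat (of_real (q x))) ** \<Psi> x = mat z ** \<Psi> x" by blast
    \<comment> \<open>The off-diagonal leading matrix swaps rows: the first row of the equation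
      determines the second row of \<open>\<Psi>'\<close>, and the second row the first.\<close>
    have \<Psi>'2: "\<Psi>' $ 2 $ j = (of_real m + of_real (q x) - z) * \<Psi> x $ 1 $ j" for j
      using arg_cong[OF eq, of "\<lambda>A. A $ 1 $ j"]
      by (simp add: matrix_matrix_mult_def sum_2 mat_def pauli2_def pauli3_def algebra_simps)
    have \<Psi>'1: "\<Psi>' $ 1 $ j = (z - of_real (q x) + of_real m) * \<Psi> x $ 2 $ j" for j
      using arg_cong[OF eq, of "\<lambda>A. A $ 2 $ j"]
      by (simp add: matrix_matrix_mult_def sum_2 mat_def pauli2_def pauli3_def algebra_simps)
    have
      "(\<Psi>' *v w) $ 1 = (z - of_real (q x) + of_real m) * (\<Psi> x *v w) $ 2"
      "(\<Psi>' *v w) $ 2 = (of_real m + of_real (q x) - z) * (\<Psi> x *v w) $ 1"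
      by (simp_all add: matrix_vector_mult_def sum_2 \<Psi>'1 \<Psi>'2 algebra_simps)
    then show "((\<lambda>x. (\<Psi> x *v w) $ 1) has_vector_derivative
          (z - of_real (q x) + of_real m) * (\<Psi> x *v w) $ 2) (at x) \<and>
        ((\<lambda>x. (\<Psi> x *v w) $ 2) has_vector_derivative
          (of_real m + of_real (q x) - z) * (\<Psi> x *v w) $ 1) (at x)"
      using bounded_linear.has_vector_derivative[OF bounded_linear_matrix_vector_mult_nth \<Psi>']
      by metis
  qed
qed

text \<open>The coefficient matrix of the first-order system has zero diagonal, hence zero trace,
  and all terms of the derivative cancel in pairs.\<close>

lemma dirac_wronskian_const:
  assumes "dirac_vector_solution m q z f g" "dirac_vector_solution m q z f' g'" "c \<le> d"
  shows "f c * g' c - g c * f' c = f d * g' d - g d * f' d"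
proof (rule abs_continuous_on_AE_zero_deriv_imp_eq[OF \<open>c \<le> d\<close>])
  show "abs_continuous_on {c..d} (\<lambda>x. f x * g' x - g x * f' x)"
    using assms unfolding dirac_vector_solution_def
    by (intro abs_continuous_on_diff abs_continuous_on_mult) auto
  let ?D = "\<lambda>f g x. (f has_vector_derivative (z - of_real (q x) + of_real m) * g x) (at x) \<and>
      (g has_vector_derivative (of_real m + of_real (q x) - z) * f x) (at x)"
  have "AE x in lebesgue. ?D f g x" "AE x in lebesgue. ?D f' g' x"
    using assms unfolding dirac_vector_solution_def by auto
  then show "AE x in lebesgue. ((\<lambda>x. f x * g' x - g x * f' x) has_vector_derivative 0) (at x)"
  proof eventually_elim
    case (elim x)
    then have
      "((\<lambda>x. f x * g' x) has_vector_derivative f x * ((of_real m + of_real (q x) - z) * f' x)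
         + (z - of_real (q x) + of_real m) * g x * g' x) (at x)"
      "((\<lambda>x. g x * f' x) has_vector_derivative g x * ((z - of_real (q x) + of_real m) * g' x)
         + (of_real m + of_real (q x) - z) * f x * f' x) (at x)"
      by (auto intro!: has_vector_derivative_mult)
    from has_vector_derivative_diff[OF this] show ?case by (simp add: algebra_simps)
  qed
qed

text \<open>The determinant is the Wronskian of the two columns. For the canonical solution this
  yields determinant 1 of the monodromy matrix.\<close>

lemma dirac_solution_det_const:
  assumes "dirac_solution m q z \<Psi>" "c \<le> d"
  shows "det (\<Psi> c) = det (\<Psi> d)"
proof -
  have "(\<Psi> x *v axis j 1) $ i = \<Psi> x $ i $ j" for x i and j :: 2
    by (simp add: matrix_vector_mult_def axis_def if_distrib cong: if_cong)
  with dirac_wronskian_const[OF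
      dirac_solution_imp_vector_solution[OF assms(1), of "axis 1 1"]
      dirac_solution_imp_vector_solution[OF assms(1), of "axis 2 1"] assms(2)]
  show ?thesis by (simp add: det_2 mult.commute)
qed

section \<open>Growth of solutions and reality of the stability set\<close>

text \<open>The modulus of \<open>Complex m (Im z)\<close> is the square root in the exponent, and
  twice the product of the moduli of \<open>f\<close> and \<open>g\<close> is at most
  \<open>E\<close>. Gronwall for \<open>E\<close> gives the lower bound, and for \<open>- E\<close>
  the upper one.\<close>

lemma dirac_vector_solution_energy_bounds:
  fixes f g :: "real \<Rightarrow> complex"
  defines "E \<equiv> \<lambda>x. (cmod (f x))\<^sup>2 + (cmod (g x))\<^sup>2"
  assumes sol: "dirac_vector_solution m q z f g" and "c \<le> d"
  shows "exp (- 2 * sqrt (m\<^sup>2 + (Im z)\<^sup>2) * (d - c)) * E c \<le> E d"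
    and "E d \<le> exp (2 * sqrt (m\<^sup>2 + (Im z)\<^sup>2) * (d - c)) * E c"
proof -
  define \<kappa> where "\<kappa> = sqrt (m\<^sup>2 + (Im z)\<^sup>2)"
  \<comment> \<open>In this form the rules for products and bounded linear maps apply to
    \<open>E\<close>.\<close>
  have E: "E x = Re (f x * cnj (f x) + g x * cnj (g x))" for x
    by (simp add: E_def cmod_power2 flip: power2_eq_square)
  have ac: "abs_continuous_on {c..d} E"
    unfolding E using sol unfolding dirac_vector_solution_def
    by (intro abs_continuous_on_bounded_linear[OF bounded_linear_Re] abs_continuous_on_add
        abs_continuous_on_mult abs_continuous_on_bounded_linear[OF bounded_linear_cnj]) auto
  have deriv: "AE x in lebesgue. \<exists>E'. \<bar>E'\<bar> \<le> 2 * \<kappa> * E x \<and> (E has_vector_derivative E') (at x)"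
  proof -
    have "AE x in lebesgue.
        (f has_vector_derivative (z - of_real (q x) + of_real m) * g x) (at x) \<and>
        (g has_vector_derivative (of_real m + of_real (q x) - z) * f x) (at x)"
      using sol unfolding dirac_vector_solution_def by auto
    then show ?thesis
    proof eventually_elim
      case (elim x)
      define f' where "f' = (z - of_real (q x) + of_real m) * g x"
      define g' where "g' = (of_real m + of_real (q x) - z) * f x"
      have d: "(f has_vector_derivative f') (at x)" "(g has_vector_derivative g') (at x)"
        using elim by (auto simp: f'_def g'_def)
      have "(E has_vector_derivative
          Re ((f x * cnj f' + f' * cnj (f x)) + (g x * cnj g' + g' * cnj (g x)))) (at x)"
        unfolding E by (intro bounded_linear.has_vector_derivative[OF bounded_linear_Re]
            has_vector_derivative_add has_vector_derivative_mult
            bounded_linear.has_vector_derivative[OF bounded_linear_cnj] d)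
      \<comment> \<open>Conjugating the contribution of \<open>g\<close> inside the real part
        replaces \<open>z\<close> by \<open>cnj z\<close>, so that \<open>q x\<close> and
        \<open>Re z\<close> cancel and only \<open>m\<close> and \<open>Im z\<close>
        survive.\<close>
      moreover have "Re ((f x * cnj f' + f' * cnj (f x)) + (g x * cnj g' + g' * cnj (g x)))
          = 4 * Re (Complex m (Im z) * (cnj (f x) * g x))"
        by (simp add: f'_def g'_def algebra_simps)
      moreover have "\<bar>4 * Re (Complex m (Im z) * (cnj (f x) * g x))\<bar> \<le> 2 * \<kappa> * E x"
      proof -
        have "\<bar>Re (Complex m (Im z) * (cnj (f x) * g x))\<bar> \<le> \<kappa> * (cmod (f x) * cmod (g x))"
          using abs_Re_le_cmod[of "Complex m (Im z) * (cnj (f x) * g x)"]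
          by (simp add: norm_mult complex_norm \<kappa>_def)
        moreover have "\<kappa> * (2 * (cmod (f x) * cmod (g x))) \<le> \<kappa> * E x"
          using sum_squares_bound[of "cmod (f x)" "cmod (g x)"]
          by (intro mult_left_mono) (auto simp: E_def \<kappa>_def mult.assoc)
        ultimately show ?thesis by simp
      qed
      ultimately show ?case by metis
    qed
  qed
  have "exp (- 2 * \<kappa> * (d - c)) * E c \<le> E d"
  proof (rule abs_continuous_on_gronwall[OF \<open>c \<le> d\<close> ac])
    show "AE x in lebesgue. \<exists>f'\<ge>- 2 * \<kappa> * E x. (E has_vector_derivative f') (at x)"
      using deriv
    proof eventually_elim
      case (elim x)
      then obtain E' where "\<bar>E'\<bar> \<le> 2 * \<kappa> * E x" "(E has_vector_derivative E') (at x)" by blast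
      then show ?case by (intro exI[of _ E']) (auto simp: abs_le_iff)
    qed
  qed
  then show "exp (- 2 * sqrt (m\<^sup>2 + (Im z)\<^sup>2) * (d - c)) * E c \<le> E d"
    by (simp add: \<kappa>_def)
  have "exp (2 * \<kappa> * (d - c)) * (- E c) \<le> - E d"
  proof (rule abs_continuous_on_gronwall[OF \<open>c \<le> d\<close>])
    show "abs_continuous_on {c..d} (\<lambda>x. - E x)"
      by (rule abs_continuous_on_bounded_linear[OF bounded_linear_minus[OF bounded_linear_ident] ac])
    show "AE x in lebesgue. \<exists>f'\<ge>2 * \<kappa> * - E x. ((\<lambda>x. - E x) has_vector_derivative f') (at x)"
      using deriv
    proof eventually_elim
      case (elim x)
      then obtain E' where "\<bar>E'\<bar> \<le> 2 * \<kappa> * E x" "(E has_vector_derivative E') (at x)" by blast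
      then show ?case
        by (intro exI[of _ "- E'"]) (auto intro: has_vector_derivative_minus)
    qed
  qed
  then show "E d \<le> exp (2 * sqrt (m\<^sup>2 + (Im z)\<^sup>2) * (d - c)) * E c"
    by (simp add: \<kappa>_def)
qed

lemma norm_complex2: "(norm (w :: complex^2))\<^sup>2 = (cmod (w $ 1))\<^sup>2 + (cmod (w $ 2))\<^sup>2"
  by (simp add: norm_vec_def L2_set_def sum_2)

lemma dirac_solution_norm_le:
  assumes "dirac_solution m q z \<Psi>" "c \<le> d"
  shows "norm (\<Psi> d *v w) \<le> exp (sqrt (m\<^sup>2 + (Im z)\<^sup>2) * (d - c)) * norm (\<Psi> c *v w)"
proof (rule power2_le_imp_le)
  show "(norm (\<Psi> d *v w))\<^sup>2 \<le> (exp (sqrt (m\<^sup>2 + (Im z)\<^sup>2) * (d - c)) * norm (\<Psi> c *v w))\<^sup>2"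
    using dirac_vector_solution_energy_bounds(2)[OF
        dirac_solution_imp_vector_solution[OF assms(1)] assms(2), of w]
    by (simp add: norm_complex2 power_mult_distrib mult.assoc flip: exp_double)
qed simp

text \<open>If \<open>D(z) \<in> [-2,2]\<close>, some Floquet solution has a multiplier of modulus one, so that
  \<open>Im (cnj u\<^sub>1 u\<^sub>2)\<close> takes the same value at both ends of the period; but its derivative is
  \<open>-Im z |u|\<^sup>2\<close>.\<close>

lemma discriminant_in_interval_imp_real:
  assumes "a > 0" and \<Phi>: "canonical_solution m q \<Phi>"
    and disc: "discriminant a \<Phi> z \<in> of_real ` {-2..2}"
  shows "Im z = 0"
proof (rule ccontr)
  assume "Im z \<noteq> 0"
  have sol: "dirac_solution m q z (\<lambda>x. \<Phi> x z)" and init: "\<Phi> 0 z = mat 1"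
    using \<Phi> by (auto simp: canonical_solution_def)
  define M where "M = \<Phi> a z"
  have det: "det M = 1"
    using dirac_solution_det_const[OF sol, of 0 a] \<open>a > 0\<close> by (simp add: M_def init)
  obtain t :: real where t: "\<bar>t\<bar> \<le> 1" "trace M = of_real (2 * t)"
  proof -
    obtain s :: real where "s \<in> {-2..2}" "trace M = of_real s"
      using disc by (auto simp: discriminant_def monodromy_def M_def)
    then show ?thesis using that[of "s / 2"] by (auto simp: abs_le_iff)
  qed
  \<comment> \<open>With trace \<open>2 * t\<close> and determinant 1, this is a root of the
    characteristic polynomial of \<open>M\<close>; it lies on the unit circle because
    \<open>\<bar>t\<bar> \<le> 1\<close>.\<close>
  define \<rho> where "\<rho> = Complex t (sqrt (1 - t\<^sup>2))"
  have "t\<^sup>2 \<le> 1" using t(1) by (simp add: abs_square_le_1)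
  have \<rho>: "cmod \<rho> = 1" using \<open>t\<^sup>2 \<le> 1\<close> by (simp add: \<rho>_def complex_norm)
  have char: "\<rho>\<^sup>2 - of_real (2 * t) * \<rho> + 1 = 0"
    using \<open>t\<^sup>2 \<le> 1\<close> by (simp add: \<rho>_def complex_eq_iff power2_eq_square algebra_simps)
  have "det (M - mat \<rho>) = \<rho>\<^sup>2 - trace M * \<rho> + det M"
    by (simp add: det_2 trace_def sum_2 mat_def algebra_simps power2_eq_square)
  then have "\<not> invertible (M - mat \<rho>)"
    using char det t(2) by (simp add: invertible_det_nz)
  then obtain w where w: "w \<noteq> 0" "(M - mat \<rho>) *v w = 0"
    unfolding invertible_left_inverse matrix_left_invertible_ker by blast
  have "mat \<rho> *v w = \<rho> *s w"
    by (simp add: matrix_vector_mult_def mat_def vec_eq_iff if_distrib[of "\<lambda>x. x * _"] cong: if_cong)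
  then have Mw: "M *v w = \<rho> *s w" using w(2) by (simp add: matrix_vector_mult_diff_rdistrib)
  define f where "f x = (\<Phi> x z *v w) $ 1" for x
  define g where "g x = (\<Phi> x z *v w) $ 2" for x
  have fg: "dirac_vector_solution m q z f g"
    unfolding f_def g_def by (rule dirac_solution_imp_vector_solution[OF sol])
  \<comment> \<open>By the lower energy bound, this is a positive lower bound for the energy over
    the whole period.\<close>
  define \<epsilon> where "\<epsilon> = exp (- 2 * sqrt (m\<^sup>2 + (Im z)\<^sup>2) * a) * (norm w)\<^sup>2"
  have "\<epsilon> > 0" using w(1) by (simp add: \<epsilon>_def)
  have lower: "\<epsilon> \<le> (cmod (f x))\<^sup>2 + (cmod (g x))\<^sup>2" if "x \<in> {0..a}" for x
  proof -
    have "\<epsilon> \<le> exp (- 2 * sqrt (m\<^sup>2 + (Im z)\<^sup>2) * (x - 0)) * (norm w)\<^sup>2"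
      unfolding \<epsilon>_def using that by (intro mult_right_mono) (auto intro: mult_left_mono)
    also have "\<dots> \<le> (cmod (f x))\<^sup>2 + (cmod (g x))\<^sup>2"
      using dirac_vector_solution_energy_bounds(1)[OF fg, of 0 x] that
      by (simp add: f_def g_def init norm_complex2)
    finally show ?thesis .
  qed
  define W where "W x = Im (cnj (f x) * g x)" for x
  \<comment> \<open>The derivative of \<open>- Im z * W x\<close> is the energy times the square of
    \<open>Im z\<close>, whatever the sign of \<open>Im z\<close>. Subtracting the linear term still
    leaves a nondecreasing function, so equal values of \<open>W\<close> at \<open>0\<close> and
    \<open>a\<close> are contradictory.\<close>
  define F where "F x = - Im z * W x - (Im z)\<^sup>2 * \<epsilon> * x" for x
  have "F 0 \<le> F a"
  proof (rule abs_continuous_on_AE_nonneg_deriv_imp_le[of 0 a F])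
    show "0 \<le> a" using \<open>a > 0\<close> by simp
    show "abs_continuous_on {0..a} F"
      using fg unfolding dirac_vector_solution_def F_def W_def
      by (intro abs_continuous_on_diff abs_continuous_on_mult abs_continuous_on_const
          abs_continuous_on_ident abs_continuous_on_bounded_linear[OF bounded_linear_Im]
          abs_continuous_on_bounded_linear[OF bounded_linear_cnj]) auto
    have "AE x in lebesgue.
        (f has_vector_derivative (z - of_real (q x) + of_real m) * g x) (at x) \<and>
        (g has_vector_derivative (of_real m + of_real (q x) - z) * f x) (at x)"
      using fg unfolding dirac_vector_solution_def by auto
    then show "AE x in lebesgue. x \<in> {0..a} \<longrightarrow>
        (\<exists>f'\<ge>0. (F has_vector_derivative f') (at x))"
    proof eventually_elim
      case (elim x)
      define f' where "f' = (z - of_real (q x) + of_real m) * g x"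
      define g' where "g' = (of_real m + of_real (q x) - z) * f x"
      have d: "(f has_vector_derivative f') (at x)" "(g has_vector_derivative g') (at x)"
        using elim by (auto simp: f'_def g'_def)
      have "(W has_vector_derivative Im (cnj (f x) * g' + cnj f' * g x)) (at x)"
        unfolding W_def by (intro bounded_linear.has_vector_derivative[OF bounded_linear_Im]
            has_vector_derivative_mult
            bounded_linear.has_vector_derivative[OF bounded_linear_cnj] d)
      moreover have "Im (cnj (f x) * g' + cnj f' * g x)
          = - Im z * ((cmod (f x))\<^sup>2 + (cmod (g x))\<^sup>2)"
        unfolding cmod_power2 by (simp add: f'_def g'_def power2_eq_square algebra_simps)
      ultimately have W': "(W has_real_derivative
          - Im z * ((cmod (f x))\<^sup>2 + (cmod (g x))\<^sup>2)) (at x)"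
        by (simp only: has_real_derivative_iff_has_vector_derivative)
      have "(F has_real_derivative
          - Im z * (- Im z * ((cmod (f x))\<^sup>2 + (cmod (g x))\<^sup>2)) - (Im z)\<^sup>2 * \<epsilon> * 1) (at x)"
        unfolding F_def by (intro DERIV_diff DERIV_cmult W' DERIV_ident)
      moreover have "- Im z * (- Im z * ((cmod (f x))\<^sup>2 + (cmod (g x))\<^sup>2)) - (Im z)\<^sup>2 * \<epsilon> * 1
          = (Im z)\<^sup>2 * ((cmod (f x))\<^sup>2 + (cmod (g x))\<^sup>2 - \<epsilon>)"
        by (simp add: power2_eq_square algebra_simps)
      ultimately have F': "(F has_vector_derivative
          (Im z)\<^sup>2 * ((cmod (f x))\<^sup>2 + (cmod (g x))\<^sup>2 - \<epsilon>)) (at x)"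
        by (simp only: has_real_derivative_iff_has_vector_derivative)
      show ?case
      proof
        assume "x \<in> {0..a}"
        then have "(Im z)\<^sup>2 * ((cmod (f x))\<^sup>2 + (cmod (g x))\<^sup>2 - \<epsilon>) \<ge> 0"
          using lower[of x] by simp
        then show "\<exists>f'\<ge>0. (F has_vector_derivative f') (at x)" using F' by blast
      qed
    qed
  qed
  moreover have "W a = W 0"
  proof -
    \<comment> \<open>Over one period both components are multiplied by \<open>\<rho>\<close>, hence
      this product by the squared modulus of \<open>\<rho>\<close>, which is 1.\<close>
    have "cnj (f a) * g a = (\<rho> * cnj \<rho>) * (cnj (f 0) * g 0)"
      using Mw by (simp add: f_def g_def init M_def mult_ac)
    then show ?thesis using \<rho> by (simp add: W_def complex_norm_square[symmetric])
  qed
  ultimately have "(Im z)\<^sup>2 * \<epsilon> * a \<le> 0" by (simp add: F_def)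
  moreover have "(Im z)\<^sup>2 * \<epsilon> * a > 0" using \<open>Im z \<noteq> 0\<close> \<open>\<epsilon> > 0\<close> \<open>a > 0\<close> by simp
  ultimately show False by linarith
qed

section \<open>Quasimomentum and the Floquet solutions\<close>

text \<open>All complex solutions of \<open>cos w = cos (arccos t)\<close> are plus or minus
  \<open>arccos t\<close> up to multiples of the period, hence real.\<close>

lemma cos_in_interval_imp_real:
  assumes "cos w = of_real t" "\<bar>t\<bar> \<le> 1"
  shows "Im w = 0"
proof -
  have "cos w = cos (of_real (arccos t))"
    using assms by (metis cos_arccos_abs cos_of_real)
  then show ?thesis by (auto simp: complex_cos_eq elim!: Ints_cases)
qed

text \<open>The map sending w to \<open>- cnj w\<close> preserves imaginary parts, so
  \<open>Im (k z)\<close> depends only on the reflection of \<open>z\<close> into the closed upper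
  half-plane.\<close>

lemma quasimomentum_Im_reflect:
  assumes "quasimomentum a \<Phi> k"
  shows "Im (k z) = Im (k (Complex (Re z) \<bar>Im z\<bar>))"
proof (cases "Im z < 0")
  case True
  then have "Complex (Re z) \<bar>Im z\<bar> = cnj z" by (simp add: complex_eq_iff)
  then show ?thesis using assms True by (simp add: quasimomentum_def)
next
  case False
  then have "Complex (Re z) \<bar>Im z\<bar> = z" by (simp add: complex_eq_iff)
  then show ?thesis by simp
qed

lemma quasimomentum_Im_nonneg:
  assumes "quasimomentum a \<Phi> k"
  shows "Im (k z) \<ge> 0"
  using assms by (simp add: quasimomentum_Im_reflect[OF assms, of z] quasimomentum_def)

text \<open>The real part of \<open>k\<close> may jump across the real axis; the imaginary part is a
  composition with the continuous folding map.\<close>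

lemma quasimomentum_Im_continuous:
  assumes "quasimomentum a \<Phi> k"
  shows "isCont (\<lambda>z. Im (k z)) z"
proof -
  have "continuous_on UNIV (\<lambda>z. Complex (Re z) \<bar>Im z\<bar>)"
    by (intro continuous_intros)
  moreover have "continuous_on {z. Im z \<ge> 0} k" using assms by (simp add: quasimomentum_def)
  ultimately have "continuous_on UNIV (\<lambda>z. k (Complex (Re z) \<bar>Im z\<bar>))"
    by (intro continuous_on_compose2[where f = "\<lambda>z. Complex (Re z) \<bar>Im z\<bar>" and g = k]) auto
  then have "continuous_on UNIV (\<lambda>z. Im (k (Complex (Re z) \<bar>Im z\<bar>)))"
    by (intro continuous_intros)
  then show ?thesis
    by (simp add: continuous_on_eq_continuous_at flip: quasimomentum_Im_reflect[OF assms])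
qed

text \<open>Points vertically above \<open>t\<close> suffice. This makes the filter of the lower
  limit nontrivial.\<close>

lemma nonreal_islimpt:
  assumes "\<And>z. Im z \<noteq> 0 \<Longrightarrow> z \<in> S"
  shows "of_real t islimpt S"
proof -
  have "\<exists>z\<in>S. z \<noteq> of_real t \<and> dist z (of_real t) < e" if "e > 0" for e :: real
  proof (intro bexI[of _ "Complex t (e / 2)"] conjI)
    have "Complex t (e / 2) - of_real t = \<i> * of_real (e / 2)" by (simp add: complex_eq_iff)
    then have "dist (Complex t (e / 2)) (of_real t) = \<bar>e / 2\<bar>"
      unfolding dist_norm by (simp only: norm_mult norm_of_real norm_ii mult_1)
    then show "dist (Complex t (e / 2)) (of_real t) < e" using that by simp
  qed (use that assms in \<open>auto simp: complex_eq_iff\<close>)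
  then show ?thesis by (auto simp: islimpt_approachable)
qed

lemma norm_complex_scale: "norm (c *s w) = cmod c * norm (w :: complex^2)"
proof -
  have "(norm (c *s w))\<^sup>2 = (cmod c * norm w)\<^sup>2"
    by (simp add: norm_complex2 norm_mult power_mult_distrib distrib_left)
  then show ?thesis by (simp add: power2_eq_iff_nonneg)
qed

section \<open>The two estimates for \<open>floquet_gamma\<close>\<close>

text \<open>The numerator is \<open>norm (v z)\<close>. The supremum is at least its value at
  \<open>x = 0\<close>, which is the same number, and at most \<open>B\<close>.\<close>

lemma floquet_gamma_bounds:
  assumes "a > 0" and \<Phi>: "canonical_solution m q \<Phi>" and k: "quasimomentum a \<Phi> k"
    and s: "s = 1 \<or> s = -1" and v: "v z \<noteq> 0"
  shows "exp (- a * (Im (k z) + sqrt (m\<^sup>2 + (Im z)\<^sup>2))) \<le> floquet_gamma s a \<Phi> k v z"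
    and "floquet_gamma s a \<Phi> k v z \<le> 1"
proof -
  define \<kappa> where "\<kappa> = sqrt (m\<^sup>2 + (Im z)\<^sup>2)"
  define \<phi> where "\<phi> x = norm (floquet_periodic s \<Phi> k v x z)" for x
  define B where "B = exp (a * (Im (k z) + \<kappa>)) * norm (v z)"
  have sol: "dirac_solution m q z (\<lambda>x. \<Phi> x z)" and init: "\<Phi> 0 z = mat 1"
    using \<Phi> by (auto simp: canonical_solution_def)
  have k_nonneg: "Im (k z) \<ge> 0" by (rule quasimomentum_Im_nonneg[OF k])
  have \<phi>0: "\<phi> 0 = norm (v z)"
    by (simp add: \<phi>_def floquet_periodic_def init norm_complex_scale)
  have le: "\<phi> x \<le> B" if x: "x \<in> {0..a}" for x
  proof -
    have "\<phi> x = exp (- s * Im (k z) * x) * norm (\<Phi> x z *v v z)"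
      by (simp add: \<phi>_def floquet_periodic_def norm_complex_scale)
    also have "\<dots> \<le> exp (a * Im (k z)) * (exp (\<kappa> * a) * norm (v z))"
    proof (intro mult_mono)
      \<comment> \<open>For \<open>s = 1\<close> the left side is at most 0; for
        \<open>s = -1\<close> equality holds.\<close>
      have "- s * Im (k z) * x \<le> Im (k z) * x"
        using s k_nonneg x by (auto intro: order_trans[of _ 0])
      also have "\<dots> \<le> a * Im (k z)"
        using k_nonneg x by (simp add: mult.commute mult_right_mono)
      finally show "exp (- s * Im (k z) * x) \<le> exp (a * Im (k z))" by simp
      have "norm (\<Phi> x z *v v z) \<le> exp (\<kappa> * x) * norm (v z)"
        using dirac_solution_norm_le[OF sol, of 0 x "v z"] x by (simp add: init \<kappa>_def)
      also have "\<dots> \<le> exp (\<kappa> * a) * norm (v z)"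
        using x by (intro mult_right_mono) (auto simp: \<kappa>_def intro: mult_left_mono)
      finally show "norm (\<Phi> x z *v v z) \<le> exp (\<kappa> * a) * norm (v z)" .
    qed auto
    also have "\<dots> = B"
      by (simp add: B_def algebra_simps exp_add)
    finally show ?thesis .
  qed
  \<comment> \<open>Without an upper bound the real supremum would be unspecified.\<close>
  have bdd: "bdd_above (\<phi> ` {0..a})" using le by (rule bdd_aboveI2)
  have sup: "norm (v z) \<le> (SUP x\<in>{0..a}. \<phi> x)"
    using cSUP_upper[OF _ bdd, of 0] \<open>a > 0\<close> by (simp add: \<phi>0)
  have "norm (v z) > 0" using v by simp
  with sup have pos: "(SUP x\<in>{0..a}. \<phi> x) > 0" by linarith
  have \<gamma>: "floquet_gamma s a \<Phi> k v z = norm (v z) / (SUP x\<in>{0..a}. \<phi> x)"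
    by (simp add: floquet_gamma_def \<phi>0 flip: \<phi>_def)
  show "floquet_gamma s a \<Phi> k v z \<le> 1"
    using sup pos by (simp add: \<gamma>)
  have "(SUP x\<in>{0..a}. \<phi> x) \<le> B"
    using \<open>a > 0\<close> le by (intro cSUP_least) auto
  then have "exp (- a * (Im (k z) + \<kappa>)) * (SUP x\<in>{0..a}. \<phi> x) \<le> exp (- a * (Im (k z) + \<kappa>)) * B"
    by simp
  also have "\<dots> = norm (v z)"
    by (simp add: B_def flip: mult.assoc exp_add)
  finally show "exp (- a * (Im (k z) + sqrt (m\<^sup>2 + (Im z)\<^sup>2))) \<le> floquet_gamma s a \<Phi> k v z"
    using pos by (simp add: \<gamma> \<kappa>_def le_divide_eq)
qed

text \<open>The pointwise bounds hold along the filter. The lower one is continuous in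
  \<open>z\<close> and tends to \<open>exp (- a * m)\<close>, as \<open>Im (k z)\<close> and
  \<open>Im z\<close> both vanish at \<open>t\<close>.\<close>

lemma floquet_gamma_Liminf_bounds:
  assumes "m \<ge> 0" and "a > 0" and \<Phi>: "canonical_solution m q \<Phi>" and k: "quasimomentum a \<Phi> k"
    and s: "s = 1 \<or> s = -1" and v: "floquet_eigenvectors s a \<Phi> k v"
    and t: "discriminant a \<Phi> (of_real t) \<in> of_real ` {-2..2}"
  defines "F \<equiv> at (complex_of_real t) within instability_set a \<Phi>"
  shows "ereal (exp (- a * m)) \<le> Liminf F (\<lambda>z. ereal (floquet_gamma s a \<Phi> k v z))"
    and "Liminf F (\<lambda>z. ereal (floquet_gamma s a \<Phi> k v z)) \<le> 1"
proof -
  have "z \<in> instability_set a \<Phi>" if "Im z \<noteq> 0" for z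
    using discriminant_in_interval_imp_real[OF \<open>a > 0\<close> \<Phi>] that
    by (auto simp: instability_set_def)
  \<comment> \<open>Along the trivial filter \<open>Liminf\<close> is infinite, and the upper bound
    would fail.\<close>
  then have nontriv: "F \<noteq> bot"
    unfolding F_def by (simp add: trivial_limit_within nonreal_islimpt)
  have "\<forall>\<^sub>F z in F. z \<in> instability_set a \<Phi>"
    unfolding F_def by (simp add: eventually_at_filter)
  then have bounds: "\<forall>\<^sub>F z in F. exp (- a * (Im (k z) + sqrt (m\<^sup>2 + (Im z)\<^sup>2)))
      \<le> floquet_gamma s a \<Phi> k v z \<and> floquet_gamma s a \<Phi> k v z \<le> 1"
  proof eventually_elim
    case (elim z)
    then have "v z \<noteq> 0" using v by (simp add: floquet_eigenvectors_def)
    then show ?case using floquet_gamma_bounds[OF \<open>a > 0\<close> \<Phi> k s] by blast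
  qed
  show "Liminf F (\<lambda>z. ereal (floquet_gamma s a \<Phi> k v z)) \<le> 1"
    using bounds by (intro Liminf_le nontriv) (auto elim: eventually_mono)
  have k_real: "Im (k (of_real t)) = 0"
  proof -
    obtain r :: real where r: "r \<in> {-2..2}" "discriminant a \<Phi> (of_real t) = of_real r"
      using t by auto
    have "discriminant a \<Phi> (of_real t) = 2 * cos (k (of_real t) * of_real a)"
      using k by (simp add: quasimomentum_def)
    then have "cos (k (of_real t) * of_real a) = of_real (r / 2)" using r(2) by simp
    then have "Im (k (of_real t) * of_real a) = 0"
      by (rule cos_in_interval_imp_real) (use r(1) in auto)
    then show ?thesis using \<open>a > 0\<close> by simp
  qed
  have "isCont (\<lambda>z. exp (- a * (Im (k z) + sqrt (m\<^sup>2 + (Im z)\<^sup>2)))) (of_real t)"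
    by (intro continuous_intros quasimomentum_Im_continuous[OF k] isCont_Im[OF continuous_ident])
  then have "((\<lambda>z. exp (- a * (Im (k z) + sqrt (m\<^sup>2 + (Im z)\<^sup>2)))) \<longlongrightarrow>
      exp (- a * (Im (k (of_real t)) + sqrt (m\<^sup>2 + (Im (of_real t))\<^sup>2)))) F"
    unfolding F_def isCont_def by (rule tendsto_within_subset) simp
  then have "((\<lambda>z. ereal (exp (- a * (Im (k z) + sqrt (m\<^sup>2 + (Im z)\<^sup>2))))) \<longlongrightarrow>
      ereal (exp (- a * m))) F"
    using \<open>m \<ge> 0\<close> by (simp add: k_real)
  then have "ereal (exp (- a * m))
      = Liminf F (\<lambda>z. ereal (exp (- a * (Im (k z) + sqrt (m\<^sup>2 + (Im z)\<^sup>2)))))"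
    by (rule lim_imp_Liminf[OF nontriv, symmetric])
  also have "\<dots> \<le> Liminf F (\<lambda>z. ereal (floquet_gamma s a \<Phi> k v z))"
    using bounds by (intro Liminf_mono) (auto elim: eventually_mono)
  finally show "ereal (exp (- a * m)) \<le> Liminf F (\<lambda>z. ereal (floquet_gamma s a \<Phi> k v z))" .
qed

theorem theorem4:
  fixes m a :: real and q :: "real \<Rightarrow> real"
    and \<Phi> :: "real \<Rightarrow> complex \<Rightarrow> complex^2^2"
    and k :: "complex \<Rightarrow> complex"
    and v_plus v_minus :: "complex \<Rightarrow> complex^2"
  assumes "m \<ge> 0" and "a > 0"
    and "\<And>c d. q absolutely_integrable_on {c..d}"
    and "\<And>x. q (x + a) = q x"
    and "canonical_solution m q \<Phi>"
    and "quasimomentum a \<Phi> k"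
    and "floquet_eigenvectors 1 a \<Phi> k v_plus"
    and "floquet_eigenvectors (- 1) a \<Phi> k v_minus"
  shows "(\<forall>z. discriminant a \<Phi> z \<notin> of_real ` {-2..2} \<longrightarrow>
           (\<forall>(s, v) \<in> {(1, v_plus), (- 1, v_minus)}.
              exp (- a * (Im (k z) + sqrt (m\<^sup>2 + (Im z)\<^sup>2))) \<le> floquet_gamma s a \<Phi> k v z \<and>
              floquet_gamma s a \<Phi> k v z \<le> 1)) \<and>
         (\<forall>z\<^sub>0::real. discriminant a \<Phi> (of_real z\<^sub>0) \<in> of_real ` {-2..2} \<longrightarrow>
           (\<forall>(s, v) \<in> {(1, v_plus), (- 1, v_minus)}.
              ereal (exp (- a * m)) \<le>
                Liminf (at (of_real z\<^sub>0) within instability_set a \<Phi>)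
                  (\<lambda>z. ereal (floquet_gamma s a \<Phi> k v z)) \<and>
              Liminf (at (of_real z\<^sub>0) within instability_set a \<Phi>)
                  (\<lambda>z. ereal (floquet_gamma s a \<Phi> k v z)) \<le> 1))"
proof (intro conjI allI impI)
  have v: "floquet_eigenvectors s a \<Phi> k v \<and> (s = 1 \<or> s = -1)"
    if "(s, v) \<in> {(1, v_plus), (- 1, v_minus)}" for s v
    using that assms(7,8) by auto
  fix z assume "discriminant a \<Phi> z \<notin> of_real ` {-2..2}"
  then have z: "z \<in> instability_set a \<Phi>" by (simp add: instability_set_def)
  show "\<forall>(s, v) \<in> {(1, v_plus), (- 1, v_minus)}.
      exp (- a * (Im (k z) + sqrt (m\<^sup>2 + (Im z)\<^sup>2))) \<le> floquet_gamma s a \<Phi> k v z \<and>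
      floquet_gamma s a \<Phi> k v z \<le> 1"
  proof clarify
    fix s :: real and v assume "(s, v) \<in> {(1, v_plus), (- 1, v_minus)}"
    from v[OF this] z have "v z \<noteq> 0" "s = 1 \<or> s = -1"
      by (auto simp: floquet_eigenvectors_def)
    then show "exp (- a * (Im (k z) + sqrt (m\<^sup>2 + (Im z)\<^sup>2))) \<le> floquet_gamma s a \<Phi> k v z \<and>
        floquet_gamma s a \<Phi> k v z \<le> 1"
      using floquet_gamma_bounds[OF assms(2,5,6)] by blast
  qed
next
  fix t :: real assume t: "discriminant a \<Phi> (of_real t) \<in> of_real ` {-2..2}"
  show "\<forall>(s, v) \<in> {(1, v_plus), (- 1, v_minus)}.
      ereal (exp (- a * m)) \<le>
        Liminf (at (of_real t) within instability_set a \<Phi>)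
          (\<lambda>z. ereal (floquet_gamma s a \<Phi> k v z)) \<and>
      Liminf (at (of_real t) within instability_set a \<Phi>)
          (\<lambda>z. ereal (floquet_gamma s a \<Phi> k v z)) \<le> 1"
    using floquet_gamma_Liminf_bounds[OF assms(1,2,5,6) _ assms(7) t]
      floquet_gamma_Liminf_bounds[OF assms(1,2,5,6) _ assms(8) t] by simp
qed

end
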